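(* Let $T$ be an $\mathcal{L}_2$ theory. If there is a $\beta$-model of $T$, then there is a $\beta$-model of $T$ that contains no countable coded $\beta$-models of $T$.
   Context: $\mathcal{L}_2$ is the standard two-sorted language of second order arithmetic. A $\beta$-model is an $\omega$-model $\mathfrak{M}$ of second order arithmetic such that for every $\Sigma^1_1$ sentence $\varphi$ with parameters in $\mathfrak{M}$, $\mathfrak{M}\vDash\varphi$ iff $\varphi$ is true. A countable coded $\omega$-model is given by a real $M$ whose slices $M_0, M_1,\dots$ are the second order part of the model; a model contains such a coded model if it contains the code $M$. *)

theory Defs
  imports Main "HOL-Library.Nat_Bijection"
begin

text \<open>The language \<open>\<L>\<^sub>2\<close>. Both sorts have variables indexed by natural numbers;
  the binders take the index of the variable that they bind. There is no primitive equality
  between sets.\<close>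

datatype l2_term =
    NVar nat
  | Zero
  | One
  | Plus l2_term l2_term
  | Times l2_term l2_term

datatype l2_form =
    Eq l2_term l2_term
  | Less l2_term l2_term
  | Mem l2_term nat  \<comment> \<open>the second argument is the index of a set variable\<close>
  | Neg l2_form
  | Conj l2_form l2_form
  | Disj l2_form l2_form
  | Impl l2_form l2_form
  | Iff l2_form l2_form
  | AllN nat l2_form
  | ExN nat l2_form
  | AllS nat l2_form
  | ExS nat l2_form

fun term_vars :: "l2_term \<Rightarrow> nat set" where
  "term_vars (NVar i) = {i}"
| "term_vars Zero = {}"
| "term_vars One = {}"
| "term_vars (Plus s t) = term_vars s \<union> term_vars t"
| "term_vars (Times s t) = term_vars s \<union> term_vars t"

fun free_num :: "l2_form \<Rightarrow> nat set" where
  "free_num (Eq s t) = term_vars s \<union> term_vars t"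
| "free_num (Less s t) = term_vars s \<union> term_vars t"
| "free_num (Mem t X) = term_vars t"
| "free_num (Neg \<phi>) = free_num \<phi>"
| "free_num (Conj \<phi> \<psi>) = free_num \<phi> \<union> free_num \<psi>"
| "free_num (Disj \<phi> \<psi>) = free_num \<phi> \<union> free_num \<psi>"
| "free_num (Impl \<phi> \<psi>) = free_num \<phi> \<union> free_num \<psi>"
| "free_num (Iff \<phi> \<psi>) = free_num \<phi> \<union> free_num \<psi>"
| "free_num (AllN i \<phi>) = free_num \<phi> - {i}"
| "free_num (ExN i \<phi>) = free_num \<phi> - {i}"
| "free_num (AllS X \<phi>) = free_num \<phi>"
| "free_num (ExS X \<phi>) = free_num \<phi>"

fun free_set :: "l2_form \<Rightarrow> nat set" where
  "free_set (Eq s t) = {}"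
| "free_set (Less s t) = {}"
| "free_set (Mem t X) = {X}"
| "free_set (Neg \<phi>) = free_set \<phi>"
| "free_set (Conj \<phi> \<psi>) = free_set \<phi> \<union> free_set \<psi>"
| "free_set (Disj \<phi> \<psi>) = free_set \<phi> \<union> free_set \<psi>"
| "free_set (Impl \<phi> \<psi>) = free_set \<phi> \<union> free_set \<psi>"
| "free_set (Iff \<phi> \<psi>) = free_set \<phi> \<union> free_set \<psi>"
| "free_set (AllN i \<phi>) = free_set \<phi>"
| "free_set (ExN i \<phi>) = free_set \<phi>"
| "free_set (AllS X \<phi>) = free_set \<phi> - {X}"
| "free_set (ExS X \<phi>) = free_set \<phi> - {X}"

definition l2_sentence :: "l2_form \<Rightarrow> bool" where
  "l2_sentence \<phi> \<longleftrightarrow> free_num \<phi> = {} \<and> free_set \<phi> = {}"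

definition l2_theory :: "l2_form set \<Rightarrow> bool" where
  "l2_theory T \<longleftrightarrow> (\<forall>\<phi>\<in>T. l2_sentence \<phi>)"

fun arithmetical :: "l2_form \<Rightarrow> bool" where
  "arithmetical (Eq s t) \<longleftrightarrow> True"
| "arithmetical (Less s t) \<longleftrightarrow> True"
| "arithmetical (Mem t X) \<longleftrightarrow> True"
| "arithmetical (Neg \<phi>) \<longleftrightarrow> arithmetical \<phi>"
| "arithmetical (Conj \<phi> \<psi>) \<longleftrightarrow> arithmetical \<phi> \<and> arithmetical \<psi>"
| "arithmetical (Disj \<phi> \<psi>) \<longleftrightarrow> arithmetical \<phi> \<and> arithmetical \<psi>"
| "arithmetical (Impl \<phi> \<psi>) \<longleftrightarrow> arithmetical \<phi> \<and> arithmetical \<psi>"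
| "arithmetical (Iff \<phi> \<psi>) \<longleftrightarrow> arithmetical \<phi> \<and> arithmetical \<psi>"
| "arithmetical (AllN i \<phi>) \<longleftrightarrow> arithmetical \<phi>"
| "arithmetical (ExN i \<phi>) \<longleftrightarrow> arithmetical \<phi>"
| "arithmetical (AllS X \<phi>) \<longleftrightarrow> False"
| "arithmetical (ExS X \<phi>) \<longleftrightarrow> False"

definition sigma11 :: "l2_form \<Rightarrow> bool" where
  "sigma11 \<phi> \<longleftrightarrow> (\<exists>X \<theta>. \<phi> = ExS X \<theta> \<and> arithmetical \<theta>)"

text \<open>An \<open>\<omega>\<close>-model has the standard natural numbers as its first order part, so it is identified
  with its second order part \<open>S\<close>, a nonempty set of reals (sets of natural numbers).\<close>

definition omega_model :: "nat set set \<Rightarrow> bool" where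
  "omega_model S \<longleftrightarrow> S \<noteq> {}"

fun eval_term :: "(nat \<Rightarrow> nat) \<Rightarrow> l2_term \<Rightarrow> nat" where
  "eval_term v (NVar i) = v i"
| "eval_term v Zero = 0"
| "eval_term v One = 1"
| "eval_term v (Plus s t) = eval_term v s + eval_term v t"
| "eval_term v (Times s t) = eval_term v s * eval_term v t"

fun sat :: "nat set set \<Rightarrow> (nat \<Rightarrow> nat) \<Rightarrow> (nat \<Rightarrow> nat set) \<Rightarrow> l2_form \<Rightarrow> bool" where
  "sat S v V (Eq s t) \<longleftrightarrow> eval_term v s = eval_term v t"
| "sat S v V (Less s t) \<longleftrightarrow> eval_term v s < eval_term v t"
| "sat S v V (Mem t X) \<longleftrightarrow> eval_term v t \<in> V X"
| "sat S v V (Neg \<phi>) \<longleftrightarrow> \<not> sat S v V \<phi>"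
| "sat S v V (Conj \<phi> \<psi>) \<longleftrightarrow> sat S v V \<phi> \<and> sat S v V \<psi>"
| "sat S v V (Disj \<phi> \<psi>) \<longleftrightarrow> sat S v V \<phi> \<or> sat S v V \<psi>"
| "sat S v V (Impl \<phi> \<psi>) \<longleftrightarrow> (sat S v V \<phi> \<longrightarrow> sat S v V \<psi>)"
| "sat S v V (Iff \<phi> \<psi>) \<longleftrightarrow> (sat S v V \<phi> \<longleftrightarrow> sat S v V \<psi>)"
| "sat S v V (AllN i \<phi>) \<longleftrightarrow> (\<forall>n. sat S (v(i := n)) V \<phi>)"
| "sat S v V (ExN i \<phi>) \<longleftrightarrow> (\<exists>n. sat S (v(i := n)) V \<phi>)"
| "sat S v V (AllS X \<phi>) \<longleftrightarrow> (\<forall>A\<in>S. sat S v (V(X := A)) \<phi>)"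
| "sat S v V (ExS X \<phi>) \<longleftrightarrow> (\<exists>A\<in>S. sat S v (V(X := A)) \<phi>)"

text \<open>Truth of a formula with parameters is satisfaction in the full \<open>\<omega>\<close>-model.\<close>

definition true_with :: "(nat \<Rightarrow> nat) \<Rightarrow> (nat \<Rightarrow> nat set) \<Rightarrow> l2_form \<Rightarrow> bool" where
  "true_with v V \<phi> \<longleftrightarrow> sat UNIV v V \<phi>"

text \<open>A sentence with parameters in \<open>S\<close> is a formula together with an assignment that supplies
  the parameters for its free variables: arbitrary numbers, and sets belonging to \<open>S\<close>.\<close>

definition beta_model :: "nat set set \<Rightarrow> bool" where
  "beta_model S \<longleftrightarrow> omega_model S \<and>
    (\<forall>\<phi> v V. sigma11 \<phi> \<and> range V \<subseteq> S \<longrightarrow> (sat S v V \<phi> \<longleftrightarrow> true_with v V \<phi>))"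

text \<open>For sentences the choice of the assignment is immaterial.\<close>

definition model_of :: "nat set set \<Rightarrow> l2_form set \<Rightarrow> bool" where
  "model_of S T \<longleftrightarrow> (\<forall>\<phi>\<in>T. \<forall>v V. range V \<subseteq> S \<longrightarrow> sat S v V \<phi>)"

definition slice :: "nat set \<Rightarrow> nat \<Rightarrow> nat set" where
  "slice M n = {m. prod_encode (n, m) \<in> M}"

definition coded_model :: "nat set \<Rightarrow> nat set set" where
  "coded_model M = range (slice M)"

end

theory Submission
  imports Defs
begin

text \<open>For a code \<open>M\<close>, let \<open>W(M)\<close> be the disjoint sum of all well-founded relations among the slices
  of \<open>M\<close>, with a greatest element on top. If \<open>N\<close> codes a \<open>\<beta>\<close>-model, well-foundedness of its slices
  can be tested inside that model, so \<open>W(N)\<close> is arithmetical in \<open>N\<close> and belongs to every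
  \<open>\<beta>\<close>-model containing \<open>N\<close>. Hence if moreover \<open>N\<close> is a slice of a code \<open>M\<close> of a \<open>\<beta>\<close>-model, then
  \<open>W(N)\<close> embeds strictly below the top of \<open>W(M)\<close>. Therefore membership between codes of
  \<open>\<beta>\<close>-models is well-founded, and a minimal code of a \<open>\<beta>\<close>-model of \<open>T\<close> gives the required model.\<close>

definition decode_rel :: "nat set \<Rightarrow> nat rel" where
  "decode_rel X = {(m, n). prod_encode (m, n) \<in> X}"

text \<open>The top is \<open>0\<close>, and \<open>Suc\<close> shifts the summands past it. Points
  of an ill-founded summand stay in the field, with no predecessors.\<close>

definition wf_sum :: "nat set \<Rightarrow> nat rel" where
  "wf_sum N = {(a, b). b = 0 \<and> a \<noteq> 0 \<or>
     (\<exists>i x y. a = Suc (prod_encode (i, x)) \<and> b = Suc (prod_encode (i, y)) \<and>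
       wf (decode_rel (slice N i)) \<and> (x, y) \<in> decode_rel (slice N i))}"

text \<open>A witness of ill-foundedness, phrased so that it is arithmetical in \<open>r\<close> and
  \<open>Y\<close>.\<close>

definition no_minimal :: "nat rel \<Rightarrow> nat set \<Rightarrow> bool" where
  "no_minimal r Y \<longleftrightarrow> (\<exists>n. n \<in> Y) \<and> (\<forall>n. n \<in> Y \<longrightarrow> (\<exists>m. m \<in> Y \<and> (m, n) \<in> r))"

lemma wf_iff_not_no_minimal: "wf r \<longleftrightarrow> \<not> (\<exists>Y. no_minimal r Y)"
  unfolding wf_eq_minimal no_minimal_def by metis

lemma decode_rel_encode: "decode_rel (prod_encode ` r) = r"
  by (simp add: decode_rel_def inj_image_mem_iff[OF inj_prod_encode])

lemma wf_wf_sum: "wf (wf_sum N)"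
proof -
  have pred: "\<exists>z. a = Suc (prod_encode (i, z)) \<and> wf (decode_rel (slice N i)) \<and>
      (z, x) \<in> decode_rel (slice N i)"
    if "(a, Suc (prod_encode (i, x))) \<in> wf_sum N" for a i x
    using that unfolding wf_sum_def by simp
  have summand: "Suc (prod_encode (i, x)) \<in> Wellfounded.acc (wf_sum N)" for i x
  proof (cases "wf (decode_rel (slice N i))")
    case True
    then show ?thesis
    proof (induction x)
      case (less x)
      show ?case
        by (rule accI) (use pred less.IH in blast)
    qed
  next
    case False
    show ?thesis
      by (rule accI) (use False pred in blast)
  qed
  have positive: "Suc p \<in> Wellfounded.acc (wf_sum N)" for p
    by (metis prod_decode_inverse surj_pair summand)
  have "0 \<in> Wellfounded.acc (wf_sum N)"
  proof (rule accI)
    fix a assume "(a, 0) \<in> wf_sum N"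
    then have "a \<noteq> 0"
      by (simp add: wf_sum_def)
    then show "a \<in> Wellfounded.acc (wf_sum N)"
      using positive not0_implies_Suc by metis
  qed
  with positive have "a \<in> Wellfounded.acc (wf_sum N)" for a
    by (cases a) simp_all
  then show ?thesis
    by (simp add: wf_iff_acc)
qed

text \<open>The induction runs along the well-founded relation of one fixed index, into which the
  relations of all indices below it are mapped.\<close>

lemma wf_if_embeds_below_top:
  fixes W :: "'a \<Rightarrow> 'b rel" and top :: "'a \<Rightarrow> 'b"
  assumes wf: "\<And>x. wf (W x)"
    and emb: "\<And>x y. (x, y) \<in> r \<Longrightarrow>
      \<exists>e. (\<forall>a b. (a, b) \<in> W x \<longrightarrow> (e a, e b) \<in> W y) \<and> (e (top x), top y) \<in> W y"
  shows "wf r"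
proof -
  have main: "x \<in> Wellfounded.acc r"
    if "\<And>a b. (a, b) \<in> W x \<Longrightarrow> (h a, h b) \<in> W z" "h (top x) = c" for x z h c
    using wf[of z] that
  proof (induction c arbitrary: x h)
    case (less c)
    show ?case
    proof (rule accI)
      fix y assume "(y, x) \<in> r"
      then obtain e where e: "\<And>a b. (a, b) \<in> W y \<Longrightarrow> (e a, e b) \<in> W x"
        "(e (top y), top x) \<in> W x"
        using emb by blast
      then have "(h (e (top y)), c) \<in> W z"
        using less.prems by blast
      moreover have "(h (e a), h (e b)) \<in> W z" if "(a, b) \<in> W y" for a b
        using that e(1) less.prems(1) by blast
      \<comment> \<open>The composite of \<open>h\<close> and \<open>e\<close> sends
        \<open>top y\<close> strictly below \<open>c\<close>, so the induction hypothesis applies to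
        it.\<close>
      ultimately show "y \<in> Wellfounded.acc r"
        using less.IH[where h = "\<lambda>a. h (e a)"] by blast
    qed
  qed
  have "x \<in> Wellfounded.acc r" for x
    using main[of x "\<lambda>a. a"] by blast
  then show ?thesis
    by (simp add: wf_iff_acc)
qed

text \<open>\<open>prod_encode (m, n)\<close> is the \<open>(m + n)\<close>-th triangular number plus \<open>m\<close>; doubling removes
  the division by two.\<close>

definition pair_form :: "nat \<Rightarrow> nat \<Rightarrow> nat \<Rightarrow> l2_form" where
  "pair_form i j k = Eq (Plus (NVar k) (NVar k))
     (Plus (Times (Plus (NVar i) (NVar j)) (Plus (Plus (NVar i) (NVar j)) One))
       (Plus (NVar i) (NVar i)))"

text \<open>The number variables 20 and 21 and the set variable 0, which denotes the code, are reserved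
  in the following formulas.\<close>

definition slice_form :: "nat \<Rightarrow> nat \<Rightarrow> l2_form" where
  "slice_form i m = ExN 20 (Conj (pair_form i m 20) (Mem (NVar 20) 0))"

definition slice_rel_form :: "nat \<Rightarrow> nat \<Rightarrow> nat \<Rightarrow> l2_form" where
  "slice_rel_form i m n = ExN 21 (Conj (pair_form m n 21) (slice_form i 21))"

text \<open>Candidate witnesses range over the slices only, so a number quantifier over indices
  replaces the set quantifier and the formula stays arithmetical.\<close>

definition slice_wf_form :: "nat \<Rightarrow> l2_form" where
  "slice_wf_form i = AllN 4 (Neg (Conj (ExN 5 (slice_form 4 5))
     (AllN 5 (Impl (slice_form 4 5) (ExN 6 (Conj (slice_form 4 6) (slice_rel_form i 6 5)))))))"

definition wf_sum_form :: l2_form where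
  "wf_sum_form = ExN 1 (ExN 2 (Conj (pair_form 1 2 0)
     (Disj (Conj (Eq (NVar 2) Zero) (Neg (Eq (NVar 1) Zero)))
       (ExN 3 (ExN 7 (ExN 8 (ExN 9 (ExN 10 (Conj (pair_form 3 7 9) (Conj (pair_form 3 8 10)
         (Conj (Eq (NVar 1) (Plus (NVar 9) One)) (Conj (Eq (NVar 2) (Plus (NVar 10) One))
           (Conj (slice_wf_form 3) (slice_rel_form 3 7 8))))))))))))))"

text \<open>Here the set variable 0 denotes the relation itself, not the code of a model.\<close>

definition ill_founded_form :: l2_form where
  "ill_founded_form = ExS 1 (Conj (ExN 0 (Mem (NVar 0) 1))
     (AllN 0 (Impl (Mem (NVar 0) 1) (ExN 1 (Conj (Mem (NVar 1) 1)
       (ExN 2 (Conj (pair_form 1 0 2) (Mem (NVar 2) 0))))))))"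

lemma arithmetical_pair_form [simp]: "arithmetical (pair_form i j k)"
  by (simp add: pair_form_def)

lemma sat_pair_form [simp]: "sat S v V (pair_form i j k) \<longleftrightarrow> v k = prod_encode (v i, v j)"
proof -
  have "2 * prod_encode (v i, v j) = (v i + v j) * (v i + v j + 1) + 2 * v i"
    by (simp add: prod_encode_def triangle_def)
  then show ?thesis
    unfolding pair_form_def sat.simps eval_term.simps by linarith
qed

lemma sat_slice_form [simp]:
  "i \<noteq> 20 \<Longrightarrow> m \<noteq> 20 \<Longrightarrow> sat S v V (slice_form i m) \<longleftrightarrow> v m \<in> slice (V 0) (v i)"
  by (simp add: slice_form_def slice_def)

lemma sat_slice_rel_form [simp]:
  "i \<notin> {20, 21} \<Longrightarrow> m \<noteq> 21 \<Longrightarrow> n \<noteq> 21 \<Longrightarrow>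
    sat S v V (slice_rel_form i m n) \<longleftrightarrow> (v m, v n) \<in> decode_rel (slice (V 0) (v i))"
  by (simp add: slice_rel_form_def decode_rel_def)

lemma sat_slice_wf_form:
  assumes "i \<notin> {4, 5, 6, 20, 21}"
  shows "sat S v V (slice_wf_form i) \<longleftrightarrow>
    \<not> (\<exists>Y \<in> coded_model (V 0). no_minimal (decode_rel (slice (V 0) (v i))) Y)"
  using assms by (auto simp: slice_wf_form_def coded_model_def no_minimal_def)

lemma sat_ill_founded_form:
  "sat S v V ill_founded_form \<longleftrightarrow> (\<exists>Y\<in>S. no_minimal (decode_rel (V 0)) Y)"
  by (simp add: ill_founded_form_def no_minimal_def decode_rel_def)

text \<open>The assumption says that the coded model judges well-foundedness of its own members
  correctly; this makes the test by slices agree with \<open>wf\<close>.\<close>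

lemma sat_wf_sum_form:
  assumes "\<And>i. (\<exists>Y \<in> coded_model (V 0). no_minimal (decode_rel (slice (V 0) i)) Y)
    \<longleftrightarrow> \<not> wf (decode_rel (slice (V 0) i))"
  shows "sat S v V wf_sum_form \<longleftrightarrow> v 0 \<in> prod_encode ` wf_sum (V 0)"
proof -
  have "sat S v V wf_sum_form \<longleftrightarrow>
      (\<exists>a b. v 0 = prod_encode (a, b) \<and> (a, b) \<in> wf_sum (V 0))"
    unfolding wf_sum_form_def wf_sum_def
    by (simp add: sat_slice_wf_form assms)
  then show ?thesis
    by (auto simp: image_iff)
qed

text \<open>Ill-foundedness is \<open>sigma11\<close>, so a true instance already has a witness in
  \<open>S\<close>.\<close>

lemma beta_model_wf_iff:
  assumes "beta_model S" "X \<in> S"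
  shows "(\<exists>Y\<in>S. no_minimal (decode_rel X) Y) \<longleftrightarrow> \<not> wf (decode_rel X)"
proof -
  have "sigma11 ill_founded_form"
    by (simp add: sigma11_def ill_founded_form_def)
  \<comment> \<open>The assignment is constant because every variable must take its value in
    \<open>S\<close>.\<close>
  moreover have "range (\<lambda>_. X) \<subseteq> S"
    using assms(2) by auto
  ultimately have "sat S v (\<lambda>_. X) ill_founded_form \<longleftrightarrow> sat UNIV v (\<lambda>_. X) ill_founded_form" for v
    using assms(1) unfolding beta_model_def true_with_def by blast
  then show ?thesis
    by (simp add: sat_ill_founded_form wf_iff_not_no_minimal)
qed

text \<open>That the set defined by \<theta> exists is a true \<open>sigma11\<close> statement with
  parameter \<open>N\<close>, hence it holds in \<open>S\<close>.\<close>

lemma beta_model_arithmetical_comprehension: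
  assumes "beta_model S" "N \<in> S" "arithmetical \<theta>"
    and sat: "\<And>S v V. V 0 = N \<Longrightarrow> sat S v V \<theta> \<longleftrightarrow> v 0 \<in> A"
  shows "A \<in> S"
proof -
  let ?\<phi> = "ExS 1 (AllN 0 (Iff (Mem (NVar 0) 1) \<theta>))"
  have "sigma11 ?\<phi>"
    using assms(3) by (simp add: sigma11_def)
  moreover have "range (\<lambda>_. N) \<subseteq> S"
    using assms(2) by auto
  ultimately have "sat S v (\<lambda>_. N) ?\<phi> \<longleftrightarrow> sat UNIV v (\<lambda>_. N) ?\<phi>" for v
    using assms(1) unfolding beta_model_def true_with_def by blast
  then have "(\<exists>Y\<in>S. \<forall>n. n \<in> Y \<longleftrightarrow> n \<in> A) \<longleftrightarrow> (\<exists>Y. \<forall>n. n \<in> Y \<longleftrightarrow> n \<in> A)"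
    by (simp add: sat)
  then have "\<exists>Y\<in>S. \<forall>n. n \<in> Y \<longleftrightarrow> n \<in> A"
    by blast
  then show ?thesis
    by (metis set_eqI)
qed

lemma wf_sum_in_beta_model:
  assumes "beta_model S" "N \<in> S" "beta_model (coded_model N)"
  shows "prod_encode ` wf_sum N \<in> S"
proof (rule beta_model_arithmetical_comprehension[OF assms(1,2)])
  show "arithmetical wf_sum_form"
    by (simp add: wf_sum_form_def slice_wf_form_def slice_rel_form_def slice_form_def)
  show "sat S' v V wf_sum_form \<longleftrightarrow> v 0 \<in> prod_encode ` wf_sum N" if "V 0 = N" for S' v V
    using sat_wf_sum_form[of V S' v] beta_model_wf_iff[OF assms(3)] that
    by (auto simp: coded_model_def)
qed

lemma wf_beta_model_codes:
  "wf {(N, M). N \<in> coded_model M \<and> beta_model (coded_model N) \<and> beta_model (coded_model M)}"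
proof (rule wf_if_embeds_below_top[where W = wf_sum and top = "\<lambda>_. 0"])
  fix N M
  assume "(N, M) \<in> {(N, M). N \<in> coded_model M \<and> beta_model (coded_model N)
    \<and> beta_model (coded_model M)}"
  then have "prod_encode ` wf_sum N \<in> coded_model M"
    using wf_sum_in_beta_model by blast
  then obtain i where "slice M i = prod_encode ` wf_sum N"
    unfolding coded_model_def by (metis imageE)
  then have i: "decode_rel (slice M i) = wf_sum N"
    by (simp add: decode_rel_encode)
  \<comment> \<open>\<open>wf_sum N\<close> is itself the \<open>i\<close>-th summand of
    \<open>wf_sum M\<close>, kept there because it is well-founded.\<close>
  let ?e = "\<lambda>x. Suc (prod_encode (i, x))"
  have "(?e a, ?e b) \<in> wf_sum M" if "(a, b) \<in> wf_sum N" for a b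
    unfolding wf_sum_def[of M] using that i wf_wf_sum[of N] by auto
  moreover have "(?e 0, 0) \<in> wf_sum M"
    by (simp add: wf_sum_def)
  ultimately show "\<exists>e. (\<forall>a b. (a, b) \<in> wf_sum N \<longrightarrow> (e a, e b) \<in> wf_sum M) \<and> (e 0, 0) \<in> wf_sum M"
    by (intro exI[of _ ?e]) blast
qed (rule wf_wf_sum)

theorem theorem4p2:
  fixes T :: "l2_form set"
  assumes "l2_theory T"
    and "\<exists>S. beta_model S \<and> model_of S T"
  shows "\<exists>S. beta_model S \<and> model_of S T \<and>
    \<not> (\<exists>M\<in>S. beta_model (coded_model M) \<and> model_of (coded_model M) T)"
proof (cases "\<exists>M. beta_model (coded_model M) \<and> model_of (coded_model M) T")
  case True
  then obtain M\<^sub>0 where "M\<^sub>0 \<in> {M. beta_model (coded_model M) \<and> model_of (coded_model M) T}"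
    by blast
  from wfE_min[OF wf_beta_model_codes this] obtain M
    where M: "M \<in> {M. beta_model (coded_model M) \<and> model_of (coded_model M) T}"
      and min: "\<And>N. (N, M) \<in> {(N, M). N \<in> coded_model M \<and> beta_model (coded_model N)
          \<and> beta_model (coded_model M)} \<Longrightarrow>
        N \<notin> {M. beta_model (coded_model M) \<and> model_of (coded_model M) T}"
    by blast
  have "\<not> (\<exists>N\<in>coded_model M. beta_model (coded_model N) \<and> model_of (coded_model N) T)"
    using M min by blast
  then show ?thesis
    using M by blast
next
  case False
  then show ?thesis
    using assms(2) by blast
qed

end
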